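(* For every $k>3$ and every $n$, $\mathcal{R}(\mathsf{Disj}_k^n)=\Omega(n)$, where the implicit constant does not depend on $k$ or $n$.
   Context: $\mathsf{Disj}_k^n$: each of $k$ players $i$ holds $(x_i^\ell)_{\ell=1}^n\in\{0,1\}^n$, and $\mathsf{Disj}_k^n(x)=\bigvee_{\ell=1}^n\bigwedge_{i=1}^k x_i^\ell$. Synchronous protocols: $k$ players, player $i$ has input $x_i$ and private randomness $R_i$, and there may be public randomness $R^p$; the protocol proceeds in global rounds, in each of which every player sends a message (possibly empty) to every other player, as a function of its input, its randomness, the public randomness and the messages received in previous rounds; each player has an output tape, and on every input and every randomness assignment every player eventually stops sending messages and writing on its output tape. A protocol computes $f$ if, on every input and every randomness, the players output $f(x)$ (zero error). Such a protocol computing $f$ is private if for every player $i$, all inputs $x,x'$ with $f(x)=f(x')$ and $x_i=x_i'$, all private random assignments $r_i$ of player $i$, all public random assignments $r^p$, and every $T$: $\Pr[\Pi_i=T\mid R_i=r_i, X=x, R^p=r^p]=\Pr[\Pi_i=T\mid R_i=r_i,X=x',R^p=r^p]$, the probability being over $R_{-i}$, where $\Pi_i$ is the sequence of all messages sent to player $i$. A protocol is $d$-random if on any run the total number of private random bits used by all players is at most $d$. The randomness complexity $\mathcal{R}(f)$ is the minimal integer $d$ such that there exists a $d$-random private protocol computing $f$. *)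

theory Defs
  imports "HOL-Probability.Probability"
begin

text \<open>
  Players are the numbers below \<open>k\<close>. A history is what one player has received so far: its
  \<open>t\<close>-th entry maps each sender to the message received from that sender in round \<open>t\<close>, so its
  length is the number of the current round. Silence is the empty string.
\<close>

type_synonym tape = "nat \<Rightarrow> bool"
type_synonym message = "bool list"
type_synonym history = "(nat \<Rightarrow> message) list"

text \<open>
  The arguments of the components are: the acting player (for \<open>msg\<close>, then the recipient), its
  input, its private random tape, the public random tape, and its history. \<open>out\<close> is the string
  appended to the output tape in the current round. \<open>used\<close> is the number of cells of the private
  tape read up to and including the current round; tapes are read from left to right.
\<close>

record 'a protocol =
  msg :: "nat \<Rightarrow> nat \<Rightarrow> 'a \<Rightarrow> tape \<Rightarrow> tape \<Rightarrow> history \<Rightarrow> message"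
  out :: "nat \<Rightarrow> 'a \<Rightarrow> tape \<Rightarrow> tape \<Rightarrow> history \<Rightarrow> bool list"
  used :: "nat \<Rightarrow> 'a \<Rightarrow> tape \<Rightarrow> tape \<Rightarrow> history \<Rightarrow> nat"

text \<open>
  A run is determined by the inputs \<open>x\<close>, the private tapes \<open>R\<close> and the public tape \<open>p\<close>.
\<close>

primrec hist :: "nat \<Rightarrow> 'a protocol \<Rightarrow> (nat \<Rightarrow> 'a) \<Rightarrow> (nat \<Rightarrow> tape) \<Rightarrow> tape \<Rightarrow> nat \<Rightarrow> nat \<Rightarrow> history"
  where
    "hist k P x R p 0 i = []"
  | "hist k P x R p (Suc t) i = hist k P x R p t i @
       [\<lambda>j. if j < k \<and> j \<noteq> i then msg P j i (x j) (R j) p (hist k P x R p t j) else []]"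

definition transcript ::
    "nat \<Rightarrow> 'a protocol \<Rightarrow> (nat \<Rightarrow> 'a) \<Rightarrow> (nat \<Rightarrow> tape) \<Rightarrow> tape \<Rightarrow> nat \<Rightarrow> nat \<Rightarrow> nat \<Rightarrow> message"
  where
    "transcript k P x R p i =
       (\<lambda>t j. if j < k \<and> j \<noteq> i then msg P j i (x j) (R j) p (hist k P x R p t j) else [])"

definition written ::
    "nat \<Rightarrow> 'a protocol \<Rightarrow> (nat \<Rightarrow> 'a) \<Rightarrow> (nat \<Rightarrow> tape) \<Rightarrow> tape \<Rightarrow> nat \<Rightarrow> nat \<Rightarrow> bool list"
  where
    "written k P x R p i t = out P i (x i) (R i) p (hist k P x R p t i)"

definition inputs :: "nat \<Rightarrow> 'a set \<Rightarrow> (nat \<Rightarrow> 'a) set"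
  where
    "inputs k D = {x. \<forall>i<k. x i \<in> D}"

text \<open>
  This ties \<open>used\<close> to the behaviour of the players: whatever a player does, including its decision
  to stop reading, depends only on the cells it has read, and cells that have been read stay read.
\<close>

definition reads_tape :: "nat \<Rightarrow> 'a protocol \<Rightarrow> bool"
  where
    "reads_tape k P \<longleftrightarrow>
       (\<forall>i<k. \<forall>a r r' p h. (\<forall>m < used P i a r p h. r m = r' m) \<longrightarrow>
          (\<forall>j. msg P i j a r p h = msg P i j a r' p h) \<and>
          out P i a r p h = out P i a r' p h \<and>
          used P i a r p h = used P i a r' p h) \<and>
       (\<forall>i<k. \<forall>a r p h m. used P i a r p h \<le> used P i a r p (h @ [m]))"

definition terminating :: "nat \<Rightarrow> 'a set \<Rightarrow> 'a protocol \<Rightarrow> bool"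
  where
    "terminating k D P \<longleftrightarrow>
       (\<forall>x \<in> inputs k D. \<forall>R p. \<forall>i<k. \<exists>t0. \<forall>t\<ge>t0.
          (\<forall>j<k. transcript k P x R p j t i = []) \<and> written k P x R p i t = [])"

definition is_protocol :: "nat \<Rightarrow> 'a set \<Rightarrow> 'a protocol \<Rightarrow> bool"
  where
    "is_protocol k D P \<longleftrightarrow> reads_tape k P \<and> terminating k D P"

text \<open>
  Zero error: the final content of every output tape is the single symbol \<open>f x\<close>.
\<close>

definition computes :: "nat \<Rightarrow> 'a set \<Rightarrow> ((nat \<Rightarrow> 'a) \<Rightarrow> bool) \<Rightarrow> 'a protocol \<Rightarrow> bool"
  where
    "computes k D f P \<longleftrightarrow>
       (\<forall>x \<in> inputs k D. \<forall>R p. \<forall>i<k. \<exists>t0. \<forall>t\<ge>t0.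
          concat (map (written k P x R p i) [0..<t]) = [f x])"

definition coin_tape :: "tape measure"
  where
    "coin_tape = (\<Pi>\<^sub>M m\<in>UNIV. measure_pmf (bernoulli_pmf (1/2)))"

text \<open>
  The private tapes are independent of each other and of the public tape, so conditioning on
  \<open>R i = r\<close> and on the public tape amounts to fixing these and drawing the tapes of the other
  players. The event below is measurable whenever \<open>reads_tape k P\<close> holds.
\<close>

definition private_protocol :: "nat \<Rightarrow> 'a set \<Rightarrow> ((nat \<Rightarrow> 'a) \<Rightarrow> bool) \<Rightarrow> 'a protocol \<Rightarrow> bool"
  where
    "private_protocol k D f P \<longleftrightarrow>
       (\<forall>i<k. \<forall>x \<in> inputs k D. \<forall>x' \<in> inputs k D. f x = f x' \<and> x i = x' i \<longrightarrow>
          (\<forall>r p T.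
             \<P>(R in (\<Pi>\<^sub>M j\<in>{..<k} - {i}. coin_tape). transcript k P x (R(i := r)) p i = T) =
             \<P>(R in (\<Pi>\<^sub>M j\<in>{..<k} - {i}. coin_tape). transcript k P x' (R(i := r)) p i = T)))"

definition d_random :: "nat \<Rightarrow> 'a set \<Rightarrow> nat \<Rightarrow> 'a protocol \<Rightarrow> bool"
  where
    "d_random k D d P \<longleftrightarrow>
       (\<forall>x \<in> inputs k D. \<forall>R p t.
          (\<Sum>i<k. used P i (x i) (R i) p (hist k P x R p t i)) \<le> d)"

text \<open>
  The value is \<open>\<infinity>\<close> if no private protocol for \<open>f\<close> uses a bounded number of random bits.
\<close>

definition randomness_complexity :: "nat \<Rightarrow> 'a set \<Rightarrow> ((nat \<Rightarrow> 'a) \<Rightarrow> bool) \<Rightarrow> enat"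
  where
    "randomness_complexity k D f =
       Inf {enat d | d. \<exists>P. is_protocol k D P \<and> computes k D f P \<and>
                            private_protocol k D f P \<and> d_random k D d P}"

definition bit_strings :: "nat \<Rightarrow> bool list set"
  where
    "bit_strings n = {v. length v = n}"

definition Disj :: "nat \<Rightarrow> nat \<Rightarrow> (nat \<Rightarrow> bool list) \<Rightarrow> bool"
  where
    "Disj k n x \<longleftrightarrow> (\<exists>l<n. \<forall>i<k. x i ! l)"

end

theory Submission
  imports Defs
begin

text \<open>
  Fix all random tapes and let one player hold the zero string, so that \<open>Disj\<close> is false whatever
  the other \<open>k - 1\<close> inputs are. Privacy forces the transcripts to determine these inputs: player
  \<open>i\<close> receives the same messages with positive probability when the others hold the complement of
  \<open>x i\<close>, and then a change of \<open>x i\<close> that does not show in the messages of player \<open>i\<close> would not show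
  in the output either. On the other hand, every transcript that a player with a given input can
  receive has, by privacy, probability at least \<open>2^(-d)\<close> on one and the same input, so there are at
  most \<open>2^d\<close> of them. An entropy argument for deterministic protocols bounds the number
  of inputs told apart by the product of these numbers over the players, so
  \<open>2^(n(k - 1)) \<le> 2^(d k)\<close>.
\<close>

section \<open>Conversations that determine the inputs\<close>

text \<open>Gibbs' inequality, from \<open>ln t \<le> t - 1\<close> at
  \<open>t = N v / (p v * S)\<close>. With \<open>p\<close> the law of a message and
  \<open>N v\<close> the number of continuations after \<open>v\<close>, it bounds the entropy of
  the message plus the mean logarithm of the number of continuations by the logarithm of their total
  number.\<close>

lemma log_sum_bound:
  fixes p N :: "'v \<Rightarrow> real"
  assumes "finite V" and p: "\<And>v. v \<in> V \<Longrightarrow> 0 < p v" "sum p V = 1"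
    and N: "\<And>v. v \<in> V \<Longrightarrow> 0 < N v"
  shows "(\<Sum>v\<in>V. p v * (ln (N v) - ln (p v))) \<le> ln (sum N V)"
proof -
  define S where "S = sum N V"
  have "V \<noteq> {}" using p(2) by auto
  then have S: "0 < S" unfolding S_def using assms by (intro sum_pos) auto
  have "p v * (ln (N v) - ln (p v) - ln S) \<le> N v / S - p v" if v: "v \<in> V" for v
  proof -
    have "ln (N v) - ln (p v) - ln S = ln (N v / (p v * S))"
      using p(1)[OF v] N[OF v] S by (simp add: ln_div ln_mult)
    also have "\<dots> \<le> N v / (p v * S) - 1"
      using p(1)[OF v] N[OF v] S by (intro ln_le_minus_one) simp
    finally have "p v * (ln (N v) - ln (p v) - ln S) \<le> p v * (N v / (p v * S) - 1)"
      using p(1)[OF v] by (intro mult_left_mono) auto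
    also have "\<dots> = N v / S - p v" using p(1)[OF v] S by (simp add: field_simps)
    finally show ?thesis .
  qed
  then have "(\<Sum>v\<in>V. p v * (ln (N v) - ln (p v) - ln S)) \<le> (\<Sum>v\<in>V. N v / S - p v)"
    by (intro sum_mono)
  also have "\<dots> = 0" using S p(2)
    by (simp add: sum_subtractf S_def flip: sum_divide_distrib)
  finally show ?thesis
    using p(2) unfolding S_def
    by (simp add: right_diff_distrib sum_subtractf flip: sum_distrib_right)
qed

section \<open>Deterministic conversations as lists of message events\<close>

type_synonym ('a, 'm) event = "nat \<times> nat \<times> ((nat \<Rightarrow> 'a) \<Rightarrow> 'm)"

text \<open>In an event \<open>(j, l, f)\<close> the sender is \<open>j\<close>, the receiver is
  \<open>l\<close>, and \<open>f\<close> gives the message as a function of the whole input vector.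
  Who speaks to whom is thus fixed in advance, and the length of what a player receives does not
  depend on the inputs.\<close>

definition received :: "('a, 'm) event list \<Rightarrow> nat \<Rightarrow> (nat \<Rightarrow> 'a) \<Rightarrow> 'm list" where
  "received ms i x = map (\<lambda>(j, l, f). f x) (filter (\<lambda>(j, l, f). l = i) ms)"

lemma received_Nil [simp]: "received [] i x = []"
  by (simp add: received_def)

lemma received_Cons [simp]:
  "received ((j, l, f) # ms) i x = (if l = i then [f x] else []) @ received ms i x"
  by (simp add: received_def)

lemma received_append [simp]: "received (ms @ ns) i x = received ms i x @ received ns i x"
  by (simp add: received_def)

lemma received_eq_iff:
  "received ms i x = received ms i y \<longleftrightarrow> (\<forall>j f. (j, i, f) \<in> set ms \<longrightarrow> f x = f y)"
  by (auto simp: received_def)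

text \<open>A message may depend only on the sender's input and on what the sender received before.
  This is required relative to a set \<open>A\<close> because the induction below passes to the
  inputs that share the first message, where that message drops out of the comparison of
  histories.\<close>

definition causal :: "('a, 'm) event list \<Rightarrow> (nat \<Rightarrow> 'a) set \<Rightarrow> bool" where
  "causal ms A \<longleftrightarrow> (\<forall>us j l f vs. ms = us @ (j, l, f) # vs \<longrightarrow>
     (\<forall>x\<in>A. \<forall>y\<in>A. x j = y j \<and> received us j x = received us j y \<longrightarrow> f x = f y))"

lemma causal_Cons_head:
  assumes "causal ((j, l, f) # ms) A" "x \<in> A" "y \<in> A" "x j = y j"
  shows "f x = f y"
  using assms unfolding causal_def by (metis append_Nil received_Nil)

lemma causal_Cons_tail:
  assumes c: "causal ((j, l, f) # ms) A"
  shows "causal ms {x \<in> A. f x = v}"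
  unfolding causal_def
proof (intro allI impI ballI, elim conjE)
  fix us j' l' f' vs x y
  assume *: "ms = us @ (j', l', f') # vs" "x \<in> {x \<in> A. f x = v}" "y \<in> {x \<in> A. f x = v}"
    "x j' = y j'" "received us j' x = received us j' y"
  have "(j, l, f) # ms = ((j, l, f) # us) @ (j', l', f') # vs" using * by simp
  moreover have "received ((j, l, f) # us) j' x = received ((j, l, f) # us) j' y"
    using * by simp
  ultimately show "f' x = f' y" using c * unfolding causal_def by blast
qed

text \<open>Meant for appending a round of simultaneous messages: each event of \<open>ns\<close>
  looks only at \<open>ms\<close>. Messages listed earlier in \<open>ns\<close> do no harm, since
  agreement on a longer history implies agreement on its part from \<open>ms\<close>, whose length
  is the same for both inputs.\<close>

lemma causal_append:
  assumes c: "causal ms A"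
    and n: "\<And>j l f x y. (j, l, f) \<in> set ns \<Longrightarrow> x \<in> A \<Longrightarrow> y \<in> A \<Longrightarrow> x j = y j \<Longrightarrow>
      received ms j x = received ms j y \<Longrightarrow> f x = f y"
  shows "causal (ms @ ns) A"
  unfolding causal_def
proof (intro allI impI ballI, elim conjE)
  fix us j l f vs x y
  assume *: "ms @ ns = us @ (j, l, f) # vs" "x \<in> A" "y \<in> A" "x j = y j"
    "received us j x = received us j y"
  from *(1) consider ws where "us = ms @ ws" "ns = ws @ (j, l, f) # vs"
    | ws where "ms = us @ ws" "ws \<noteq> []" "ws @ ns = (j, l, f) # vs"
    by (auto simp: append_eq_append_conv2) (metis append.right_neutral append_Nil)
  then show "f x = f y"
  proof cases
    case 1
    then have "received ms j x = received ms j y"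
      using *(5) by (simp add: received_def append_eq_append_conv)
    then show ?thesis using n[of j l f x y] 1 * by auto
  next
    case 2
    then obtain ws' where "ms = us @ (j, l, f) # ws'" by (cases ws) auto
    then show ?thesis using c * unfolding causal_def by blast
  qed
qed

text \<open>Only the number of views is used: its logarithm is the stand-in for the entropy of what
  player \<open>i\<close> receives given its input \<open>a\<close>.\<close>

definition views :: "nat \<Rightarrow> ('a, 'm) event list \<Rightarrow> (nat \<Rightarrow> 'a set) \<Rightarrow> nat \<Rightarrow> 'a \<Rightarrow> 'm list set" where
  "views k ms B i a = received ms i ` {x \<in> Pi\<^sub>E {..<k} B. x i = a}"

lemma finite_views: "(\<And>i. i < k \<Longrightarrow> finite (B i)) \<Longrightarrow> finite (views k ms B i a)"
  unfolding views_def by (intro finite_imageI finite_subset[OF _ finite_PiE[of "{..<k}" B]]) auto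

lemma views_nonempty:
  assumes "\<And>i. i < k \<Longrightarrow> B i \<noteq> {}" "i < k" "a \<in> B i"
  shows "views k ms B i a \<noteq> {}"
proof -
  obtain x where "x \<in> Pi\<^sub>E {..<k} B" using assms(1) by (fastforce simp: PiE_eq_empty_iff)
  then have "x(i := a) \<in> {x \<in> Pi\<^sub>E {..<k} B. x i = a}"
    using assms(2,3) by (auto simp: PiE_iff extensional_def)
  then show ?thesis unfolding views_def by blast
qed

text \<open>
  In entropy terms: the entropy of the whole conversation is at most the sum over the players of
  the entropy of what a player receives given its input. A message from player \<open>j\<close> splits the box
  of inputs along \<open>j\<close> only, with proportions that do not depend on the input of the receiver.
\<close>

lemma card_box_le_views:
  fixes ms :: "('a, 'm) event list"
  assumes "\<And>i. i < k \<Longrightarrow> finite (B i)" "\<And>i. i < k \<Longrightarrow> B i \<noteq> {}"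
    and "causal ms (Pi\<^sub>E {..<k} B)"
    and "\<And>j l f. (j, l, f) \<in> set ms \<Longrightarrow> j < k \<and> l < k \<and> j \<noteq> l"
    and "\<And>x y. x \<in> Pi\<^sub>E {..<k} B \<Longrightarrow> y \<in> Pi\<^sub>E {..<k} B \<Longrightarrow>
      (\<And>i. i < k \<Longrightarrow> received ms i x = received ms i y) \<Longrightarrow> x = y"
  shows "(\<Sum>i<k. ln (real (card (B i)))) \<le>
    (\<Sum>i<k. (\<Sum>a\<in>B i. ln (real (card (views k ms B i a)))) / real (card (B i)))"
  using assms
proof (induction ms arbitrary: B)
  case Nil
  obtain x0 where x0: "x0 \<in> Pi\<^sub>E {..<k} B" using Nil(2) by (fastforce simp: PiE_eq_empty_iff)
  \<comment> \<open>Without messages nothing separates two inputs, so the box is a single point and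
    the left side is 0.\<close>
  have "card (B i) = 1" if i: "i < k" for i
  proof -
    have "a = x0 i" if a: "a \<in> B i" for a
    proof -
      have "x0(i := a) \<in> Pi\<^sub>E {..<k} B" using x0 i a by (auto simp: PiE_iff extensional_def)
      then have "x0(i := a) = x0" using Nil(5) x0 by simp
      then show ?thesis by (metis fun_upd_same)
    qed
    then have "B i = {x0 i}" using Nil(2)[OF i] by auto
    then show ?thesis by simp
  qed
  moreover have "0 \<le> (\<Sum>i<k. (\<Sum>a\<in>B i. ln (real (card (views k ([]::('a, 'm) event list) B i a)))) / real (card (B i)))"
  proof (intro sum_nonneg divide_nonneg_nonneg)
    fix i a assume "i \<in> {..<k}" "a \<in> B i"
    then have "views k ([]::('a, 'm) event list) B i a \<noteq> {}" using views_nonempty Nil(2) by (metis lessThan_iff)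
    then have "1 \<le> card (views k ([]::('a, 'm) event list) B i a)"
      using finite_views[OF Nil(1)] by (simp add: Suc_le_eq card_gt_0_iff)
    then show "0 \<le> ln (real (card (views k ([]::('a, 'm) event list) B i a)))" by simp
  qed simp
  ultimately show ?case by simp
next
  case (Cons e ms)
  obtain j l f where e: "e = (j, l, f)" by (cases e) auto
  have jl: "j < k" "l < k" "j \<noteq> l" using Cons.prems(4)[of j l f] e by auto
  note fin = Cons.prems(1) and ne = Cons.prems(2)
  obtain x0 where x0: "x0 \<in> Pi\<^sub>E {..<k} B" using ne by (fastforce simp: PiE_eq_empty_iff)
  \<comment> \<open>The first message has an empty history, hence depends on the sender's input
    alone; \<open>x0\<close> merely fills in the other coordinates.\<close>
  define g where "g a = f (x0(j := a))" for a
  define D where "D v = B(j := {a \<in> B j. g a = v})" for v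
  define V where "V = g ` B j"
  \<comment> \<open>The probability that the first message is \<open>v\<close>, for inputs uniform
    on the box; \<open>D v\<close> is the subbox of inputs that produce it.\<close>
  define p where "p v = real (card (D v j)) / real (card (B j))" for v
  have fg: "f x = g (x j)" if "x \<in> Pi\<^sub>E {..<k} B" for x
    unfolding g_def using that x0 jl
    by (intro causal_Cons_head[OF Cons.prems(3)[unfolded e]]) (auto simp: PiE_iff extensional_def)
  have box: "Pi\<^sub>E {..<k} (D v) = {x \<in> Pi\<^sub>E {..<k} B. f x = v}" for v
  proof (intro set_eqI iffI)
    fix x assume x: "x \<in> Pi\<^sub>E {..<k} (D v)"
    then have "x \<in> Pi\<^sub>E {..<k} B" by (auto simp: PiE_iff D_def split: if_splits)
    moreover have "x j \<in> D v j" using x jl by auto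
    ultimately show "x \<in> {x \<in> Pi\<^sub>E {..<k} B. f x = v}" using fg by (auto simp: D_def)
  next
    fix x assume "x \<in> {x \<in> Pi\<^sub>E {..<k} B. f x = v}"
    then show "x \<in> Pi\<^sub>E {..<k} (D v)" using fg by (auto simp: PiE_iff D_def)
  qed
  have finV: "finite V" unfolding V_def using fin jl by simp
  have finD: "finite (D v i)" if "i < k" for v i using that fin jl by (auto simp: D_def)
  have neD: "D v i \<noteq> {}" if "i < k" "v \<in> V" for v i
    using that ne by (auto simp: D_def V_def)
  have cB: "0 < card (B i)" if "i < k" for i using fin ne that by (simp add: card_gt_0_iff)
  have cD: "0 < card (D v i)" if "i < k" "v \<in> V" for v i
    using finD neD that by (simp add: card_gt_0_iff)
  have p: "0 < p v" if "v \<in> V" for v using cB cD jl that by (simp add: p_def)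
  have group: "(\<Sum>v\<in>V. \<Sum>a\<in>D v j. h a) = (\<Sum>a\<in>B j. h a)" for h :: "'a \<Rightarrow> real"
    unfolding D_def V_def using sum.group[OF fin[OF jl(1)] finite_imageI[OF fin[OF jl(1)]], of g g h]
    by (simp add: V_def)
  have p1: "sum p V = 1"
    using group[of "\<lambda>_. 1"] cB[OF jl(1)] unfolding p_def
    by (simp flip: sum_divide_distrib of_nat_sum)
  define N where "N v i a = real (card (views k ms (D v) i a))" for v i a
  define M where "M i a = real (card (views k (e # ms) B i a))" for i a
  define A where "A v i = (\<Sum>a\<in>D v i. ln (N v i a)) / real (card (D v i))" for v i
  have N0: "0 < N v i a" if "i < k" "v \<in> V" "a \<in> D v i" for v i a
    unfolding N_def using views_nonempty[of k "D v" i a ms] finite_views[of k "D v" ms i a]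
      neD finD that by (simp add: card_gt_0_iff)
  \<comment> \<open>The first event adds nothing to what players other than \<open>l\<close>
    receive, so their views only shrink when the box does.\<close>
  have NM: "N v i a \<le> M i a" if "i \<noteq> l" for v i a
    unfolding N_def M_def views_def e using that fin
    by (auto intro!: card_mono image_mono finite_imageI finite_subset[OF _ finite_PiE[of "{..<k}" B]]
        simp: box)
  have IH: "(\<Sum>i<k. ln (real (card (D v i)))) \<le> (\<Sum>i<k. A v i)" if v: "v \<in> V" for v
    unfolding A_def N_def
  proof (rule Cons.IH)
    show "causal ms (Pi\<^sub>E {..<k} (D v))"
      unfolding box using Cons.prems(3) e by (auto intro: causal_Cons_tail)
  next
    fix x y assume xy: "x \<in> Pi\<^sub>E {..<k} (D v)" "y \<in> Pi\<^sub>E {..<k} (D v)"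
      and "\<And>i. i < k \<Longrightarrow> received ms i x = received ms i y"
    then show "x = y" unfolding box using Cons.prems(5)[of x y] by (auto simp: e)
  next
    fix j' l' f' assume "(j', l', f') \<in> set ms"
    then show "j' < k \<and> l' < k \<and> j' \<noteq> l'" using Cons.prems(4)[of j' l' f'] by simp
  qed (use finD neD v in auto)
  \<comment> \<open>The weight \<open>p v\<close> cancels the denominator
    \<open>card (D v j)\<close>, and the sets \<open>D v j\<close> partition \<open>B j\<close>: the
    mean over \<open>v\<close> becomes a mean over \<open>B j\<close>.\<close>
  have sender: "(\<Sum>v\<in>V. p v * A v j) \<le> (\<Sum>a\<in>B j. ln (M j a)) / real (card (B j))"
  proof -
    have "(\<Sum>v\<in>V. p v * A v j) = (\<Sum>v\<in>V. \<Sum>a\<in>D v j. ln (N (g a) j a)) / real (card (B j))"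
      unfolding sum_divide_distrib[of _ V]
    proof (rule sum.cong[OF refl])
      fix v assume v: "v \<in> V"
      have "(\<Sum>a\<in>D v j. ln (N v j a)) = (\<Sum>a\<in>D v j. ln (N (g a) j a))"
        by (rule sum.cong) (auto simp: D_def)
      then show "p v * A v j = (\<Sum>a\<in>D v j. ln (N (g a) j a)) / real (card (B j))"
        using cD[OF jl(1) v] by (simp add: p_def A_def)
    qed
    also have "\<dots> = (\<Sum>a\<in>B j. ln (N (g a) j a)) / real (card (B j))" by (simp add: group)
    also have "\<dots> \<le> (\<Sum>a\<in>B j. ln (M j a)) / real (card (B j))"
    proof (intro divide_right_mono sum_mono)
      fix a assume "a \<in> B j"
      then have "0 < N (g a) j a" using N0 jl by (auto simp: V_def D_def)
      then show "ln (N (g a) j a) \<le> ln (M j a)" using NM[of j "g a" a] jl by simp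
    qed simp
    finally show ?thesis .
  qed
  have other: "(\<Sum>v\<in>V. p v * A v i) \<le> (\<Sum>a\<in>B i. ln (M i a)) / real (card (B i))"
    if i: "i < k" "i \<noteq> j" "i \<noteq> l" for i
  proof -
    have Di: "D v i = B i" for v using i by (simp add: D_def)
    have "(\<Sum>v\<in>V. p v * A v i) \<le> (\<Sum>v\<in>V. p v * ((\<Sum>a\<in>B i. ln (M i a)) / real (card (B i))))"
    proof (intro sum_mono mult_left_mono)
      fix v assume v: "v \<in> V"
      show "A v i \<le> (\<Sum>a\<in>B i. ln (M i a)) / real (card (B i))"
        unfolding A_def Di
      proof (intro divide_right_mono sum_mono)
        fix a assume "a \<in> B i"
        then have "0 < N v i a" using N0 i v by (auto simp: Di)
        then show "ln (N v i a) \<le> ln (M i a)" using NM[of i v a] i by simp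
      qed simp
    qed (use p in \<open>auto simp: less_imp_le\<close>)
    also have "\<dots> = (\<Sum>a\<in>B i. ln (M i a)) / real (card (B i))"
      using p1 by (simp only: sum_distrib_right[symmetric] mult_1)
    finally show ?thesis .
  qed
  \<comment> \<open>The entropy of the first message.\<close>
  define H where "H = (\<Sum>v\<in>V. p v * (- ln (p v)))"
  have receiver: "H + (\<Sum>v\<in>V. p v * A v l) \<le> (\<Sum>a\<in>B l. ln (M l a)) / real (card (B l))"
  proof -
    have Dl: "D v l = B l" for v using jl by (simp add: D_def)
    have step: "H + (\<Sum>v\<in>V. p v * ln (N v l a)) \<le> ln (M l a)" if a: "a \<in> B l" for a
    proof -
      have "H + (\<Sum>v\<in>V. p v * ln (N v l a)) = (\<Sum>v\<in>V. p v * (ln (N v l a) - ln (p v)))"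
        by (simp add: H_def algebra_simps sum_subtractf sum_negf)
      also have "\<dots> \<le> ln (\<Sum>v\<in>V. N v l a)"
        using finV p p1 N0 jl a by (intro log_sum_bound) (auto simp: Dl)
      also have "\<dots> \<le> ln (M l a)"
      proof -
        \<comment> \<open>For the receiver, putting \<open>v\<close> in front of the later messages
          keeps the views of different subboxes disjoint, so their numbers add up.\<close>
        have "(\<Sum>v\<in>V. card (views k ms (D v) l a)) = card (\<Union>v\<in>V. Cons v ` views k ms (D v) l a)"
          using finV finite_views[of k "D v" ms l a for v] finD
          by (subst card_UN_disjoint) (auto simp: card_image)
        also have "\<dots> \<le> card (views k (e # ms) B l a)"
        proof (rule card_mono)
          show "(\<Union>v\<in>V. Cons v ` views k ms (D v) l a) \<subseteq> views k (e # ms) B l a"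
            unfolding views_def e box by (auto simp: image_iff)
        qed (use finite_views fin in metis)
        finally have "(\<Sum>v\<in>V. N v l a) \<le> M l a"
          unfolding N_def M_def by (simp flip: of_nat_sum)
        moreover have "0 < (\<Sum>v\<in>V. N v l a)"
          using finV N0 jl a p1 by (intro sum_pos) (auto simp: Dl)
        ultimately show ?thesis by simp
      qed
      finally show ?thesis .
    qed
    have "H + (\<Sum>v\<in>V. p v * A v l) = (\<Sum>a\<in>B l. H + (\<Sum>v\<in>V. p v * ln (N v l a))) / real (card (B l))"
    proof -
      have "(\<Sum>v\<in>V. p v * A v l) = (\<Sum>v\<in>V. \<Sum>a\<in>B l. p v * ln (N v l a)) / real (card (B l))"
        unfolding A_def Dl by (simp add: sum_divide_distrib sum_distrib_left)
      also have "\<dots> = (\<Sum>a\<in>B l. \<Sum>v\<in>V. p v * ln (N v l a)) / real (card (B l))"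
        by (subst sum.swap) simp
      finally show ?thesis using cB[OF jl(2)] by (simp add: sum.distrib add_divide_distrib)
    qed
    also have "\<dots> \<le> (\<Sum>a\<in>B l. ln (M l a)) / real (card (B l))"
      by (intro divide_right_mono sum_mono step) auto
    finally show ?thesis .
  qed
  \<comment> \<open>Only side \<open>j\<close> of the box is cut, by the factor \<open>p v\<close>.
    Averaging over \<open>v\<close> then loses exactly \<open>H\<close>.\<close>
  have ln_D: "(\<Sum>i<k. ln (real (card (D v i)))) = (\<Sum>i<k. ln (real (card (B i)))) + ln (p v)"
    if v: "v \<in> V" for v
  proof -
    have "(\<Sum>i<k. ln (real (card (D v i)))) = ln (real (card (D v j))) + (\<Sum>i\<in>{..<k} - {j}. ln (real (card (B i))))"
      using jl by (subst sum.remove[of _ j]) (auto simp: D_def)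
    moreover have "(\<Sum>i<k. ln (real (card (B i)))) = ln (real (card (B j))) + (\<Sum>i\<in>{..<k} - {j}. ln (real (card (B i))))"
      using jl by (subst sum.remove[of _ j]) auto
    ultimately show ?thesis using cD[OF jl(1) v] cB[OF jl(1)] by (simp add: p_def ln_div)
  qed
  have "(\<Sum>i<k. ln (real (card (B i)))) = H + (\<Sum>v\<in>V. p v * (\<Sum>i<k. ln (real (card (D v i)))))"
  proof -
    have "(\<Sum>v\<in>V. p v * (\<Sum>i<k. ln (real (card (D v i))))) =
      (\<Sum>v\<in>V. p v * ((\<Sum>i<k. ln (real (card (B i)))) + ln (p v)))"
      using ln_D by (intro sum.cong) auto
    also have "\<dots> = (\<Sum>i<k. ln (real (card (B i)))) - H"
      using p1 by (simp add: H_def distrib_left sum.distrib sum_negf flip: sum_distrib_right)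
    finally show ?thesis by simp
  qed
  also have "\<dots> \<le> H + (\<Sum>v\<in>V. p v * (\<Sum>i<k. A v i))"
    using p by (intro add_left_mono sum_mono[OF mult_left_mono[OF IH]]) (auto simp: less_imp_le)
  also have "\<dots> = H + (\<Sum>i<k. \<Sum>v\<in>V. p v * A v i)"
    by (simp add: sum_distrib_left) (rule sum.swap)
  \<comment> \<open>The lost entropy \<open>H\<close> is charged to the receiver alone.\<close>
  also have "\<dots> = (\<Sum>i<k. (if i = l then H else 0) + (\<Sum>v\<in>V. p v * A v i))"
    using jl by (simp add: sum.distrib sum.delta)
  also have "\<dots> \<le> (\<Sum>i<k. (\<Sum>a\<in>B i. ln (M i a)) / real (card (B i)))"
    using sender receiver other by (intro sum_mono) (auto split: if_splits)
  finally show ?case unfolding M_def .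
qed

text \<open>With at most \<open>N\<close> views for each player and input, every average in the
  entropy bound is at most \<open>ln N\<close>; exponentiating gives the product form.\<close>

lemma card_box_le_power:
  fixes ms :: "('a, 'm) event list"
  assumes "\<And>i. i < k \<Longrightarrow> finite (B i)" "\<And>i. i < k \<Longrightarrow> B i \<noteq> {}"
    and "causal ms (Pi\<^sub>E {..<k} B)"
    and "\<And>j l f. (j, l, f) \<in> set ms \<Longrightarrow> j < k \<and> l < k \<and> j \<noteq> l"
    and "\<And>x y. x \<in> Pi\<^sub>E {..<k} B \<Longrightarrow> y \<in> Pi\<^sub>E {..<k} B \<Longrightarrow>
      (\<And>i. i < k \<Longrightarrow> received ms i x = received ms i y) \<Longrightarrow> x = y"
    and le: "\<And>i a. i < k \<Longrightarrow> a \<in> B i \<Longrightarrow> card (views k ms B i a) \<le> N"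
  shows "(\<Prod>i<k. card (B i)) \<le> N ^ k"
proof (cases "k = 0")
  case False
  have cB: "0 < card (B i)" if "i < k" for i using assms(1,2) that by (simp add: card_gt_0_iff)
  have v0: "0 < card (views k ms B i a)" if "i < k" "a \<in> B i" for i a
    using views_nonempty[of k B i a ms] finite_views[of k B ms i a] assms(1,2) that
    by (simp add: card_gt_0_iff)
  obtain a where "a \<in> B 0" using assms(2)[of 0] False by auto
  then have N: "0 < N" using le[of 0 a] v0[of 0 a] False by simp
  have "ln (\<Prod>i<k. real (card (B i))) = (\<Sum>i<k. ln (real (card (B i))))"
    using cB by (subst ln_prod) auto
  also have "\<dots> \<le> (\<Sum>i<k. (\<Sum>a\<in>B i. ln (real (card (views k ms B i a)))) / real (card (B i)))"
    by (rule card_box_le_views) (use assms in auto)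
  also have "\<dots> \<le> (\<Sum>i<k. (\<Sum>a\<in>B i. ln (real N)) / real (card (B i)))"
    using le v0 N by (intro sum_mono divide_right_mono) auto
  also have "\<dots> = (\<Sum>i<k. ln (real N))"
    using cB by (intro sum.cong) auto
  also have "\<dots> = ln (real N ^ k)" using N by (simp add: ln_realpow)
  finally have "(\<Prod>i<k. real (card (B i))) \<le> real N ^ k"
    using cB N by (subst (asm) ln_le_cancel_iff) (auto intro!: prod_pos)
  then have "real (\<Prod>i<k. card (B i)) \<le> real (N ^ k)" by simp
  then show ?thesis by (simp only: of_nat_le_iff)
qed simp

section \<open>Runs and coin tapes\<close>

lemma hist_eq_map: "hist k P x R p t i = map (transcript k P x R p i) [0..<t]"
  by (induction t) (auto simp: transcript_def)

text \<open>If two runs exchange the same messages across the cut between \<open>S\<close> and its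
  complement, then in the mixed run neither side can notice that the other side belongs to a
  different run. Induction on the rounds.\<close>

lemma cut_and_paste:
  assumes cut: "\<And>t s u. s \<in> S \<Longrightarrow> u \<notin> S \<Longrightarrow> s < k \<Longrightarrow> u < k \<Longrightarrow>
      transcript k P x R p u t s = transcript k P y Q p u t s \<and>
      transcript k P x R p s t u = transcript k P y Q p s t u"
    and i: "i < k"
  shows "hist k P (\<lambda>j. if j \<in> S then x j else y j) (\<lambda>j. if j \<in> S then R j else Q j) p t i =
    (if i \<in> S then hist k P x R p t i else hist k P y Q p t i)"
  using i
proof (induction t arbitrary: i)
  case (Suc t)
  note IH = Suc.IH
  show ?case
  proof (cases "i \<in> S")
    case True
    have "msg P j i (y j) (Q j) p (hist k P y Q p t j) = msg P j i (x j) (R j) p (hist k P x R p t j)"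
      if "j < k" "j \<notin> S" for j
      using cut[OF True that(2) Suc.prems that(1), of t] True that Suc.prems
      by (auto simp: transcript_def split: if_splits)
    then show ?thesis using True Suc.prems IH by auto
  next
    case False
    have "msg P j i (x j) (R j) p (hist k P x R p t j) = msg P j i (y j) (Q j) p (hist k P y Q p t j)"
      if "j < k" "j \<in> S" for j
      using cut[OF that(2) False that(1) Suc.prems, of t] False that Suc.prems
      by (auto simp: transcript_def split: if_splits)
    then show ?thesis using False Suc.prems IH by auto
  qed
qed simp

lemma computes_output_eq:
  assumes "computes k D f P" "x \<in> inputs k D" "y \<in> inputs k D" "j < k"
    and "\<And>t. written k P x R p j t = written k P y Q p j t"
  shows "f x = f y"
proof -
  obtain t0 where "\<forall>t\<ge>t0. concat (map (written k P x R p j) [0..<t]) = [f x]"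
    using assms unfolding computes_def by blast
  moreover obtain t1 where "\<forall>t\<ge>t1. concat (map (written k P y Q p j) [0..<t]) = [f y]"
    using assms unfolding computes_def by blast
  moreover have "written k P x R p j = written k P y Q p j" using assms(5) by auto
  ultimately show ?thesis by (metis list.inject max.cobounded1 max.cobounded2)
qed

lemma msg_read_cells:
  assumes "reads_tape k P" "i < k" "\<And>m. m < used P i a r p h \<Longrightarrow> r m = r' m"
  shows "msg P i j a r p h = msg P i j a r' p h"
proof -
  have "\<forall>m < used P i a r p h. r m = r' m" using assms(3) by simp
  then show ?thesis using assms(1,2) unfolding reads_tape_def by blast
qed

text \<open>Agreement is required only on the cells read in the run with \<open>R\<close>; by
  induction on the rounds the run with \<open>Q\<close> has the same histories.\<close>

lemma read_cells_determine_run: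
  assumes P: "reads_tape k P"
    and agree: "\<And>j t m. j < k \<Longrightarrow> m < used P j (x j) (R j) p (hist k P x R p t j) \<Longrightarrow> R j m = Q j m"
    and i: "i < k"
  shows "hist k P x Q p t i = hist k P x R p t i"
  using i
proof (induction t arbitrary: i)
  case (Suc t)
  have "msg P j i (x j) (R j) p (hist k P x R p t j) = msg P j i (x j) (Q j) p (hist k P x R p t j)"
    if "j < k" for j
    using that agree by (intro msg_read_cells[OF P]) auto
  then show ?case using Suc by auto
qed simp

corollary read_cells_determine_transcript:
  assumes "reads_tape k P"
    and "\<And>j t m. j < k \<Longrightarrow> m < used P j (x j) (R j) p (hist k P x R p t j) \<Longrightarrow> R j m = Q j m"
    and "i < k"
  shows "transcript k P x Q p i = transcript k P x R p i"
proof
  fix t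
  have "map (transcript k P x Q p i) [0..<Suc t] = map (transcript k P x R p i) [0..<Suc t]"
    using read_cells_determine_run[OF assms(1), of x R p Q i "Suc t"] assms(2,3)
    unfolding hist_eq_map by blast
  then show "transcript k P x Q p i t = transcript k P x R p i t" by simp
qed

lemma used_mono:
  assumes "reads_tape k P" "i < k" "s \<le> t"
  shows "used P i a r p (hist k P x R p s i) \<le> used P i a r p (hist k P x R p t i)"
  using assms(3)
proof (induction rule: dec_induct)
  case (step t)
  then show ?case using assms(1,2) unfolding reads_tape_def by (auto intro: order_trans)
qed simp

text \<open>The total number of cells read is bounded by \<open>d\<close>, so it attains a maximum
  at some round \<open>s\<close>. Each player's count is nondecreasing, so none can grow after
  \<open>s\<close> without increasing the total.\<close>

lemma ex_last_read:
  assumes P: "reads_tape k P" and d: "d_random k D d P" and x: "x \<in> inputs k D"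
  obtains s where "\<And>t i. i < k \<Longrightarrow>
    used P i (x i) (R i) p (hist k P x R p t i) \<le> used P i (x i) (R i) p (hist k P x R p s i)"
proof -
  define u where "u t i = used P i (x i) (R i) p (hist k P x R p t i)" for t i
  have "\<forall>t. (\<Sum>i<k. u t i) \<le> d" using d x unfolding d_random_def u_def by blast
  then obtain s where s: "\<And>t. (\<Sum>i<k. u t i) \<le> (\<Sum>i<k. u s i)"
    using ex_has_greatest_nat[of "\<lambda>_. True" 0 "\<lambda>t. \<Sum>i<k. u t i" "Suc d"]
    by (auto simp: less_Suc_eq_le)
  have mono: "u t i \<le> u t' i" if "t \<le> t'" "i < k" for t t' i
    unfolding u_def using used_mono[OF P] that by blast
  have "u t i \<le> u s i" if i: "i < k" for t i
  proof (rule ccontr)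
    assume "\<not> u t i \<le> u s i"
    then have "u s i < u (max s t) i" using mono[of t "max s t" i] i by linarith
    then have "\<exists>i\<in>{..<k}. u s i < u (max s t) i" using i by blast
    then have "(\<Sum>i<k. u s i) < (\<Sum>i<k. u (max s t) i)"
      using mono[of s "max s t"] by (intro sum_strict_mono_ex1) auto
    then show False using s[of "max s t"] by simp
  qed
  then show ?thesis using that unfolding u_def by blast
qed

section \<open>Events of the coin tapes determined by finitely many cells\<close>

lemma space_coin_tape [simp]: "space coin_tape = UNIV"
  by (simp add: coin_tape_def space_PiM)

lemma prob_space_coin_tape: "prob_space coin_tape"
  unfolding coin_tape_def by (intro prob_space_PiM prob_space_measure_pmf)

lemma measurable_cell: "(\<lambda>r. r m) \<in> coin_tape \<rightarrow>\<^sub>M count_space UNIV"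
  using measurable_component_singleton[of m UNIV "\<lambda>_. measure_pmf (bernoulli_pmf (1/2))"]
  unfolding coin_tape_def by simp

lemma sets_prefix: "{r. \<forall>m<u. r m = s m} \<in> sets coin_tape"
proof -
  have "{r \<in> space coin_tape. \<forall>m\<in>{..<u}. r m = s m} \<in> sets coin_tape"
  proof (intro sets.sets_Collect_finite_All)
    fix m
    show "{r \<in> space coin_tape. r m = s m} \<in> sets coin_tape"
      using measurable_sets[OF measurable_cell[of m], of "{s m}"] by (simp add: vimage_def)
  qed simp
  then show ?thesis by (simp add: Ball_def)
qed

lemma measure_prefix: "measure coin_tape {r. \<forall>m<u. r m = s m} = (1/2) ^ u"
proof -
  interpret product_prob_space "\<lambda>_. measure_pmf (bernoulli_pmf (1/2))" "UNIV :: nat set" ..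
  have "{r. \<forall>m<u. r m = s m} = prod_emb UNIV (\<lambda>_. measure_pmf (bernoulli_pmf (1/2))) {..<u} (\<Pi>\<^sub>E m\<in>{..<u}. {s m})"
    by (auto simp: prod_emb_def PiE_iff restrict_def)
  then have "measure coin_tape {r. \<forall>m<u. r m = s m} = (\<Prod>m\<in>{..<u}. measure (measure_pmf (bernoulli_pmf (1/2))) {s m})"
    unfolding coin_tape_def by (simp add: measure_PiM_emb)
  also have "\<dots> = (\<Prod>m\<in>{..<u}. 1/2)"
    by (intro prod.cong) (auto simp: measure_pmf_single pmf_bernoulli_half)
  finally show ?thesis by simp
qed

lemma measure_prefixes:
  assumes "finite J"
  shows "measure (\<Pi>\<^sub>M j\<in>J. coin_tape) (\<Pi>\<^sub>E j\<in>J. {r. \<forall>m<u j. r m = s j m}) = (1/2) ^ (\<Sum>j\<in>J. u j)"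
proof -
  interpret finite_product_prob_space "\<lambda>_. coin_tape" J
    using assms prob_space_coin_tape
    by (simp add: finite_product_prob_space_def finite_product_sigma_finite_def
      product_prob_space_def product_prob_space_axioms_def product_sigma_finite_def
      finite_product_sigma_finite_axioms_def prob_space_imp_sigma_finite)
  show ?thesis
    by (simp add: prob_times sets_prefix measure_prefix power_sum)
qed

text \<open>Such an event is a finite union of cylinders, one for each pattern of the first
  \<open>d\<close> cells that satisfies \<open>Q\<close>. Patterns are taken extensional so that
  there are finitely many.\<close>

lemma sets_finitely_many_cells:
  assumes J: "finite J"
    and Q: "\<And>R R'. (\<And>j m. j \<in> J \<Longrightarrow> m < d \<Longrightarrow> R j m = R' j m) \<Longrightarrow> Q R \<longleftrightarrow> Q R'"
  shows "{R \<in> space (\<Pi>\<^sub>M j\<in>J. coin_tape). Q R} \<in> sets (\<Pi>\<^sub>M j\<in>J. coin_tape)"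
proof -
  define G where "G = {g \<in> J \<rightarrow>\<^sub>E {..<d} \<rightarrow>\<^sub>E (UNIV :: bool set). Q g}"
  have "finite (J \<rightarrow>\<^sub>E {..<d} \<rightarrow>\<^sub>E (UNIV :: bool set))" using J by (intro finite_PiE) auto
  then have "finite G" unfolding G_def by simp
  define C where "C g j = {r :: tape. \<forall>m<d. r m = g j m}" for g :: "'a \<Rightarrow> tape" and j
  have "Q R \<longleftrightarrow> (\<exists>g\<in>G. \<forall>j\<in>J. R j \<in> C g j)" for R
  proof
    assume "Q R"
    then have "Q (\<lambda>j\<in>J. \<lambda>m\<in>{..<d}. R j m)" by (subst Q[of _ R]) auto
    then show "\<exists>g\<in>G. \<forall>j\<in>J. R j \<in> C g j"
      unfolding G_def C_def by (intro bexI[of _ "\<lambda>j\<in>J. \<lambda>m\<in>{..<d}. R j m"]) auto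
  next
    assume "\<exists>g\<in>G. \<forall>j\<in>J. R j \<in> C g j"
    then obtain g where "Q g" "\<And>j m. j \<in> J \<Longrightarrow> m < d \<Longrightarrow> R j m = g j m"
      unfolding G_def C_def by auto
    then show "Q R" using Q by blast
  qed
  moreover have "{R \<in> space (\<Pi>\<^sub>M j\<in>J. coin_tape). \<exists>g\<in>G. \<forall>j\<in>J. R j \<in> C g j} \<in> sets (\<Pi>\<^sub>M j\<in>J. coin_tape)"
  proof (rule sets.sets_Collect_finite_Ex)
    fix g
    show "{R \<in> space (\<Pi>\<^sub>M j\<in>J. coin_tape). \<forall>j\<in>J. R j \<in> C g j} \<in> sets (\<Pi>\<^sub>M j\<in>J. coin_tape)"
    proof (rule sets.sets_Collect_finite_All)
      fix j assume "j \<in> J"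
      then have "(\<lambda>R. R j) -` C g j \<inter> space (\<Pi>\<^sub>M j\<in>J. coin_tape) \<in> sets (\<Pi>\<^sub>M j\<in>J. coin_tape)"
        unfolding C_def by (rule measurable_sets[OF measurable_component_singleton[of j J "\<lambda>_. coin_tape"] sets_prefix])
      moreover have "{R \<in> space (\<Pi>\<^sub>M j\<in>J. coin_tape). R j \<in> C g j} =
        (\<lambda>R. R j) -` C g j \<inter> space (\<Pi>\<^sub>M j\<in>J. coin_tape)" by blast
      ultimately show "{R \<in> space (\<Pi>\<^sub>M j\<in>J. coin_tape). R j \<in> C g j} \<in> sets (\<Pi>\<^sub>M j\<in>J. coin_tape)"
        by (simp only:)
    qed (rule J)
  qed (rule \<open>finite G\<close>)
  ultimately show ?thesis by presburger
qed

lemma sets_transcript_event: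
  assumes P: "reads_tape k P" and d: "d_random k D d P" and x: "x \<in> inputs k D" and i: "i < k"
  shows "{R \<in> space (\<Pi>\<^sub>M j\<in>{..<k} - {i}. coin_tape). transcript k P x (R(i := r)) p i = T}
    \<in> sets (\<Pi>\<^sub>M j\<in>{..<k} - {i}. coin_tape)"
proof (rule sets_finitely_many_cells[where d=d])
  fix R R' :: "nat \<Rightarrow> tape"
  assume eq: "\<And>j m. j \<in> {..<k} - {i} \<Longrightarrow> m < d \<Longrightarrow> R j m = R' j m"
  have "transcript k P x (R'(i := r)) p i = transcript k P x (R(i := r)) p i"
  proof (rule read_cells_determine_transcript[OF P _ i])
    fix j t m
    assume j: "j < k"
      and m: "m < used P j (x j) ((R(i := r)) j) p (hist k P x (R(i := r)) p t j)" (is "_ < ?u j")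
    have "?u j \<le> (\<Sum>j<k. ?u j)" using j by (intro member_le_sum) auto
    also have "\<dots> \<le> d" using d x unfolding d_random_def by blast
    finally have "m < d" using m by linarith
    then show "(R(i := r)) j m = (R'(i := r)) j m"
      using j eq[of j m] by (cases "j = i") auto
  qed
  then show "(transcript k P x (R(i := r)) p i = T) = (transcript k P x (R'(i := r)) p i = T)" by simp
qed simp

text \<open>The run does not change when the other tapes keep the cells that it reads. These are at
  most \<open>d\<close> cells, so the corresponding cylinder has probability at least
  \<open>(1/2) ^ d\<close>.\<close>

lemma transcript_prob_ge:
  assumes P: "reads_tape k P" and d: "d_random k D d P" and x: "x \<in> inputs k D" and i: "i < k"
  shows "(1/2) ^ d \<le> \<P>(Q in (\<Pi>\<^sub>M j\<in>{..<k} - {i}. coin_tape).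
    transcript k P x (Q(i := R i)) p i = transcript k P x R p i)"
proof -
  interpret prob_space "\<Pi>\<^sub>M j\<in>{..<k} - {i}. coin_tape"
    by (intro prob_space_PiM prob_space_coin_tape)
  obtain s where s: "\<And>t j. j < k \<Longrightarrow>
      used P j (x j) (R j) p (hist k P x R p t j) \<le> used P j (x j) (R j) p (hist k P x R p s j)"
    using ex_last_read[OF P d x] by blast
  define u where "u j = used P j (x j) (R j) p (hist k P x R p s j)" for j
  have "(\<Sum>j\<in>{..<k} - {i}. u j) \<le> (\<Sum>j<k. u j)" by (intro sum_mono2) auto
  also have "\<dots> \<le> d" unfolding u_def using d x unfolding d_random_def by blast
  finally have "(1/2) ^ d \<le> (1/2 :: real) ^ (\<Sum>j\<in>{..<k} - {i}. u j)"
    by (intro power_decreasing) auto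
  also have "\<dots> = prob (\<Pi>\<^sub>E j\<in>{..<k} - {i}. {r. \<forall>m<u j. r m = R j m})"
    by (simp add: measure_prefixes)
  also have "\<dots> \<le> \<P>(Q in (\<Pi>\<^sub>M j\<in>{..<k} - {i}. coin_tape).
    transcript k P x (Q(i := R i)) p i = transcript k P x R p i)"
  proof (rule finite_measure_mono)
    show "(\<Pi>\<^sub>E j\<in>{..<k} - {i}. {r. \<forall>m<u j. r m = R j m}) \<subseteq>
      {Q \<in> space (\<Pi>\<^sub>M j\<in>{..<k} - {i}. coin_tape).
        transcript k P x (Q(i := R i)) p i = transcript k P x R p i}"
    proof (safe)
      fix Q assume Q: "Q \<in> (\<Pi>\<^sub>E j\<in>{..<k} - {i}. {r. \<forall>m<u j. r m = R j m})"
      then show "Q \<in> space (\<Pi>\<^sub>M j\<in>{..<k} - {i}. coin_tape)" by (auto simp: space_PiM PiE_iff)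
      show "transcript k P x (Q(i := R i)) p i = transcript k P x R p i"
      proof (rule read_cells_determine_transcript[OF P _ i])
        fix j t m assume j: "j < k" and m: "m < used P j (x j) (R j) p (hist k P x R p t j)"
        then have "m < u j" using s[OF j, of t] unfolding u_def by simp
        then show "R j m = (Q(i := R i)) j m" using Q j by (auto simp: PiE_iff)
      qed
    qed
  qed (rule sets_transcript_event[OF P d x i])
  finally show ?thesis .
qed

section \<open>Consequences of privacy\<close>

text \<open>
  By privacy the transcripts that player \<open>i\<close> can receive on the inputs \<open>A\<close> all have positive
  probability on one and the same input.
\<close>

lemma card_transcripts_le:
  assumes P: "reads_tape k P" and d: "d_random k D d P" and priv: "private_protocol k D f P"
    and i: "i < k" and A: "A \<subseteq> inputs k D" "finite A"
    and f: "\<And>x y. x \<in> A \<Longrightarrow> y \<in> A \<Longrightarrow> f x = f y \<and> x i = y i"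
  shows "card ((\<lambda>x. transcript k P x R p i) ` A) \<le> 2 ^ d"
proof (cases "A = {}")
  case False
  then obtain z where z: "z \<in> A" by blast
  interpret prob_space "\<Pi>\<^sub>M j\<in>{..<k} - {i}. coin_tape"
    by (intro prob_space_PiM prob_space_coin_tape)
  let ?T = "(\<lambda>x. transcript k P x R p i) ` A"
  define E where "E T = {Q \<in> space (\<Pi>\<^sub>M j\<in>{..<k} - {i}. coin_tape).
    transcript k P z (Q(i := R i)) p i = T}" for T
  have E: "E T \<in> events" for T
    unfolding E_def using sets_transcript_event[OF P d _ i] z A by blast
  have "(1/2) ^ d \<le> prob (E T)" if "T \<in> ?T" for T
  proof -
    obtain x where x: "x \<in> A" "T = transcript k P x R p i" using \<open>T \<in> ?T\<close> by blast
    have "(1/2) ^ d \<le> \<P>(Q in (\<Pi>\<^sub>M j\<in>{..<k} - {i}. coin_tape).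
        transcript k P x (Q(i := R i)) p i = T)"
      unfolding x using transcript_prob_ge[OF P d _ i] x A by blast
    also have "\<dots> = prob (E T)"
      unfolding E_def using priv i x z A f[of x z] unfolding private_protocol_def by blast
    finally show ?thesis .
  qed
  \<comment> \<open>Different transcripts give disjoint events on the reference input
    \<open>z\<close>, so their probabilities sum to at most 1.\<close>
  then have "card ?T * (1/2) ^ d \<le> (\<Sum>T\<in>?T. prob (E T))"
    by (intro sum_bounded_below) auto
  also have "\<dots> = prob (\<Union>T\<in>?T. E T)"
    using A E by (intro finite_measure_finite_Union[symmetric]) (auto simp: disjoint_family_on_def E_def)
  also have "\<dots> \<le> 1" by simp
  finally have "real (card ?T) \<le> real (2 ^ d)" by (simp add: power_one_over field_simps)
  then show ?thesis by (simp only: of_nat_le_iff)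
qed simp

text \<open>
  Privacy towards player \<open>i\<close> lets us replace the other inputs by the complement of \<open>x i\<close> without
  changing what player \<open>i\<close> receives; if \<open>x' i\<close> produced the same conversation with the others, then
  switching from \<open>x i\<close> to \<open>x' i\<close> would go unnoticed although the value of \<open>Disj\<close> changes.
\<close>

lemma Disj_transcripts_differ:
  assumes P: "reads_tape k P" and comp: "computes k (bit_strings n) (Disj k n) P"
    and priv: "private_protocol k (bit_strings n) (Disj k n) P"
    and d: "d_random k (bit_strings n) d P"
    and k: "2 \<le> k" "i < k" and x: "x \<in> inputs k (bit_strings n)" "x' \<in> inputs k (bit_strings n)"
    and zero: "\<not> Disj k n x"
    and l: "l < n" "\<not> x i ! l" "x' i ! l"
    and same: "\<And>j. j < k \<Longrightarrow> transcript k P x R p j = transcript k P x' R p j"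
  shows False
proof -
  define T where "T = transcript k P x R p i"
  define z where "z j = (if j = i then x i else map Not (x i))" for j
  have len: "length (x i) = n" "length (x' i) = n" using x k by (auto simp: inputs_def bit_strings_def)
  have z: "z \<in> inputs k (bit_strings n)" "z i = x i" using len by (auto simp: inputs_def bit_strings_def z_def)
  obtain j where j: "j < k" "j \<noteq> i" 
    using k that[of "if i = 0 then 1 else 0"] by (auto split: if_splits)
  have Dz: "\<not> Disj k n z"
  proof
    assume "Disj k n z"
    then obtain m where "m < n" "z i ! m" "z j ! m" using k j by (auto simp: Disj_def)
    then show False using j len by (simp add: z_def)
  qed
  have "0 < (1/2 :: real) ^ d" by simp
  also have "\<dots> \<le> \<P>(Q in (\<Pi>\<^sub>M j\<in>{..<k} - {i}. coin_tape). transcript k P x (Q(i := R i)) p i = T)"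
    unfolding T_def by (rule transcript_prob_ge[OF P d x(1) k(2)])
  also have "\<dots> = \<P>(Q in (\<Pi>\<^sub>M j\<in>{..<k} - {i}. coin_tape). transcript k P z (Q(i := R i)) p i = T)"
  proof -
    have "Disj k n x = Disj k n z \<and> x i = z i" using zero Dz z by simp
    then show ?thesis using priv k(2) x(1) z(1) unfolding private_protocol_def by blast
  qed
  \<comment> \<open>Positive probability yields actual tapes on which player \<open>i\<close>
    receives \<open>T\<close> while the others hold the complement.\<close>
  finally have "{Q \<in> space (\<Pi>\<^sub>M j\<in>{..<k} - {i}. coin_tape). transcript k P z (Q(i := R i)) p i = T} \<noteq> {}"
    by (intro notI) simp
  then obtain Q0 where Q0: "transcript k P z (Q0(i := R i)) p i = T" by blast
  define Q where "Q = Q0(i := R i)"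
  have Q: "transcript k P z Q p i = T" "Q i = R i" using Q0 by (simp_all add: Q_def)
  \<comment> \<open>In the mixed run player \<open>i\<close> holds \<open>x' i\<close> with its old
    tape, and the others hold the complement of \<open>x i\<close> with the tapes just
    found.\<close>
  define w where "w = (\<lambda>j. if j \<in> {i} then x' j else z j)"
  define W where "W = (\<lambda>j. if j \<in> {i} then R j else Q j)"
  have w: "w \<in> inputs k (bit_strings n)" using x z by (auto simp: inputs_def w_def)
  have hi: "hist k P x R p t i = hist k P z Q p t i" for t
    using Q unfolding hist_eq_map T_def by simp
  have "hist k P w W p t j = hist k P z Q p t j" for t
  proof -
    have "hist k P w W p t j = (if j \<in> {i} then hist k P x' R p t j else hist k P z Q p t j)"
      unfolding w_def W_def
    \<comment> \<open>The messages into \<open>i\<close> are \<open>T\<close> in both runs. Those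
      from \<open>i\<close> agree on \<open>x\<close> and \<open>z\<close>, where it has the same
      input, tape and history, and agree on \<open>x\<close> and \<open>x'\<close> by
      \<open>same\<close>.\<close>
    proof (rule cut_and_paste)
      fix t s u assume su: "s \<in> {i}" "u \<notin> {i}" "s < k" "u < k"
      have "transcript k P x' R p u t i = transcript k P x R p u t i"
        using same[OF su(4)] by simp
      also have "\<dots> = transcript k P z Q p u t i"
        unfolding transcript_def using hi z Q by simp
      finally show "transcript k P x' R p u t s = transcript k P z Q p u t s \<and>
          transcript k P x' R p s t u = transcript k P z Q p s t u"
        using su same[OF k(2)] Q T_def by auto
    qed (rule j)
    then show ?thesis using j by simp
  qed
  then have "written k P w W p j t = written k P z Q p j t" for t
    using j by (simp add: written_def w_def W_def)
  then have "Disj k n w = Disj k n z"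
    using computes_output_eq[OF comp w z(1) j(1)] by blast
  \<comment> \<open>At position \<open>l\<close> the string \<open>x' i\<close> has a one, and so
    does the complement of \<open>x i\<close>.\<close>
  moreover have "Disj k n w"
    unfolding Disj_def using l len by (intro exI[of _ l]) (auto simp: w_def z_def)
  ultimately show False using Dz by simp
qed

section \<open>The lower bound\<close>

text \<open>The messages of the first rounds, with all tapes fixed. Silence is recorded as the
  message \<open>[]\<close>, which keeps the list of senders and receivers independent of the
  inputs.\<close>

primrec conversation ::
    "nat \<Rightarrow> 'a protocol \<Rightarrow> (nat \<Rightarrow> tape) \<Rightarrow> tape \<Rightarrow> nat \<Rightarrow> ('a, message) event list" where
  "conversation k P R p 0 = []"
| "conversation k P R p (Suc t) = conversation k P R p t @
     [(j, i, \<lambda>x. transcript k P x R p i t j). j \<leftarrow> [0..<k], i \<leftarrow> [0..<k], j \<noteq> i]"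

lemma set_conversation:
  "(j, i, f) \<in> set (conversation k P R p T) \<longleftrightarrow>
     j < k \<and> i < k \<and> j \<noteq> i \<and> (\<exists>t<T. f = (\<lambda>x. transcript k P x R p i t j))"
  by (induction T) (auto simp: less_Suc_eq)

text \<open>The list records only senders below \<open>k\<close> other than \<open>i\<close>; at all
  other senders \<open>transcript\<close> is \<open>[]\<close> by default.\<close>

lemma received_conversation_eq_iff:
  assumes "i < k"
  shows "received (conversation k P R p T) i x = received (conversation k P R p T) i y \<longleftrightarrow>
    (\<forall>t<T. transcript k P x R p i t = transcript k P y R p i t)"
proof
  assume "received (conversation k P R p T) i x = received (conversation k P R p T) i y"
  then have *: "transcript k P x R p i t j = transcript k P y R p i t j"
    if "t < T" "j < k" "j \<noteq> i" for t j
    using that assms unfolding received_eq_iff set_conversation by blast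
  show "\<forall>t<T. transcript k P x R p i t = transcript k P y R p i t"
  proof (intro allI impI ext)
    fix t j assume "t < T"
    then show "transcript k P x R p i t j = transcript k P y R p i t j"
      using * by (cases "j < k \<and> j \<noteq> i") (auto simp: transcript_def)
  qed
next
  assume "\<forall>t<T. transcript k P x R p i t = transcript k P y R p i t"
  then show "received (conversation k P R p T) i x = received (conversation k P R p T) i y"
    unfolding received_eq_iff set_conversation by auto
qed

lemma causal_conversation: "causal (conversation k P R p T) A"
proof (induction T)
  case (Suc T)
  show ?case
    unfolding conversation.simps
  proof (rule causal_append[OF Suc])
    fix j i f x y
    assume "(j, i, f) \<in> set [(j, i, \<lambda>x. transcript k P x R p i T j). j \<leftarrow> [0..<k], i \<leftarrow> [0..<k], j \<noteq> i]"
    then have f: "j < k" "f = (\<lambda>x. transcript k P x R p i T j)" by auto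
    assume "received (conversation k P R p T) j x = received (conversation k P R p T) j y"
    then have "\<forall>t<T. transcript k P x R p j t = transcript k P y R p j t"
      by (simp only: received_conversation_eq_iff[OF f(1)])
    then have "hist k P x R p T j = hist k P y R p T j" by (simp add: hist_eq_map)
    moreover assume "x j = y j"
    ultimately show "f x = f y" by (simp add: f transcript_def)
  qed
qed (simp add: causal_def)

lemma card_image_le_if_determined:
  assumes "finite S" "\<And>x y. x \<in> S \<Longrightarrow> y \<in> S \<Longrightarrow> F x = F y \<Longrightarrow> G x = G y"
  shows "card (G ` S) \<le> card (F ` S)"
proof -
  have "G x = (G \<circ> inv_into S F) (F x)" if "x \<in> S" for x
    using assms(2)[OF that, of "inv_into S F (F x)"] that
    by (simp add: inv_into_into f_inv_into_f)
  then have "G ` S = (G \<circ> inv_into S F) ` F ` S" by (auto simp: image_image)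
  then show ?thesis using assms(1) by (metis card_image_le finite_imageI)
qed

lemma card_bit_strings: "finite (bit_strings n)" "card (bit_strings n) = 2 ^ n"
  using finite_lists_length_eq[of "UNIV :: bool set" n] card_lists_length_eq[of "UNIV :: bool set" n]
  by (simp_all add: bit_strings_def)

section \<open>Counting inputs against transcripts\<close>

lemma Disj_random_bits_ge:
  assumes prot: "is_protocol k (bit_strings n) P" and comp: "computes k (bit_strings n) (Disj k n) P"
    and priv: "private_protocol k (bit_strings n) (Disj k n) P"
    and d: "d_random k (bit_strings n) d P"
    and k: "2 \<le> k"
  shows "n * (k - 1) \<le> d * k"
proof -
  note P = prot[unfolded is_protocol_def, THEN conjunct1]
  \<comment> \<open>An arbitrary choice of tapes: the conversation becomes a deterministic function
    of the inputs.\<close>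
  define R :: "nat \<Rightarrow> tape" where "R = (\<lambda>_ _. False)"
  define p :: tape where "p = (\<lambda>_. False)"
  define B where "B i = (if i = 0 then {replicate n False} else bit_strings n)" for i :: nat
  define C where "C = Pi\<^sub>E {..<k} B"
  have finB: "finite (B i)" for i by (simp add: B_def card_bit_strings)
  have neB: "B i \<noteq> {}" for i
    using card_bit_strings(2)[of n] by (auto simp: B_def)
  have finC: "finite C" unfolding C_def using finB by (intro finite_PiE) auto
  have C: "x \<in> inputs k (bit_strings n)" "\<not> Disj k n x" if x: "x \<in> C" for x
  proof -
    have "B i \<subseteq> bit_strings n" for i by (auto simp: B_def bit_strings_def)
    then show "x \<in> inputs k (bit_strings n)" using x by (fastforce simp: C_def inputs_def)
    have "x 0 = replicate n False" 
      using PiE_mem[of x "{..<k}" B 0] x k by (simp add: C_def B_def)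
    then show "\<not> Disj k n x" using k unfolding Disj_def by (metis nth_replicate less_le_trans zero_less_numeral)
  qed
  \<comment> \<open>The box is finite, so one round \<open>T\<close> serves as the end of the
    conversation for all its inputs and players.\<close>
  have "eventually (\<lambda>t. \<forall>x\<in>C. \<forall>i\<in>{..<k}. \<forall>j<k. transcript k P x R p j t i = []) sequentially"
  proof (intro eventually_ball_finite ballI finC)
    fix x i assume "x \<in> C" "i \<in> {..<k}"
    then have "\<exists>t0. \<forall>t\<ge>t0. (\<forall>j<k. transcript k P x R p j t i = []) \<and> written k P x R p i t = []"
      using C prot unfolding is_protocol_def terminating_def by blast
    then show "eventually (\<lambda>t. \<forall>j<k. transcript k P x R p j t i = []) sequentially"
      unfolding eventually_sequentially by blast
  qed simp
  then obtain T where T: "\<And>t x i j. T \<le> t \<Longrightarrow> x \<in> C \<Longrightarrow> i < k \<Longrightarrow> j < k \<Longrightarrow> transcript k P x R p j t i = []"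
    unfolding eventually_sequentially by blast
  let ?ms = "conversation k P R p T"
  have no_separation: False if "x \<in> C" "y \<in> C" "i < k" "l < n" "\<not> x i ! l" "y i ! l"
    "\<And>j. j < k \<Longrightarrow> transcript k P x R p j = transcript k P y R p j" for x y i l
    using Disj_transcripts_differ[OF P comp priv d k] C that by blast
  have inj: "x = y" if xy: "x \<in> C" "y \<in> C" and same: "\<And>i. i < k \<Longrightarrow> received ?ms i x = received ?ms i y" for x y
  proof (rule ccontr)
    have tr: "transcript k P x R p j = transcript k P y R p j" if j: "j < k" for j
    proof (intro ext)
      fix t i
      show "transcript k P x R p j t i = transcript k P y R p j t i"
      proof (cases "t < T")
        case True
        then show ?thesis using same[OF j] unfolding received_conversation_eq_iff[OF j] by simp
      next
        case False
        then show ?thesis using T[of t x i j] T[of t y i j] xy j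
          by (cases "i < k") (auto simp: transcript_def)
      qed
    qed
    assume "x \<noteq> y"
    then obtain i where i: "i < k" "x i \<noteq> y i"
      using xy unfolding C_def by (metis PiE_ext lessThan_iff)
    moreover have "length (x i) = n" "length (y i) = n"
      using C xy i by (auto simp: inputs_def bit_strings_def)
    ultimately obtain l where l: "l < n" "x i ! l \<noteq> y i ! l"
      by (auto simp: list_eq_iff_nth_eq)
    \<comment> \<open>The separation is one-sided, from a zero to a one; which of \<open>x\<close>
      and \<open>y\<close> has the zero at \<open>l\<close> decides the order.\<close>
    show False
      using no_separation[OF xy i(1) l(1)] no_separation[OF xy(2,1) i(1) l(1)] l(2) tr by metis
  qed
  have "(\<Prod>i<k. card (B i)) \<le> (2 ^ d) ^ k"
  proof (rule card_box_le_power[where ms = ?ms])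
    show "x = y" if "x \<in> Pi\<^sub>E {..<k} B" "y \<in> Pi\<^sub>E {..<k} B"
      "\<And>i. i < k \<Longrightarrow> received ?ms i x = received ?ms i y" for x y
      using inj that unfolding C_def by blast
    fix i a assume i: "i < k"
    let ?A = "{x \<in> C. x i = a}"
    \<comment> \<open>The messages of the first \<open>T\<close> rounds are determined by the full
      transcript. On \<open>?A\<close> the value of \<open>Disj\<close> and the input of
      \<open>i\<close> are constant, as needed for the count based on privacy.\<close>
    have "card (views k ?ms B i a) \<le> card ((\<lambda>x. transcript k P x R p i) ` ?A)"
      unfolding views_def C_def[symmetric]
      using finC by (intro card_image_le_if_determined) (auto simp: received_conversation_eq_iff[OF i])
    also have "\<dots> \<le> 2 ^ d"
      using C finC by (intro card_transcripts_le[OF P d priv i]) auto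
    finally show "card (views k ?ms B i a) \<le> 2 ^ d" .
  qed (use finB neB causal_conversation set_conversation in blast)+
  moreover have "(\<Prod>i<k. card (B i)) = 2 ^ (n * (k - 1))"
  proof -
    have "(\<Prod>i<k. card (B i)) = card (B 0) * (\<Prod>i\<in>{..<k} - {0}. card (B i))"
      using k by (intro prod.remove) auto
    also have "\<dots> = (\<Prod>i\<in>{..<k} - {0}. 2 ^ n)"
      by (simp add: B_def card_bit_strings)
    finally show ?thesis using k by (simp add: power_mult)
  qed
  ultimately have "(2::nat) ^ (n * (k - 1)) \<le> 2 ^ (d * k)" by (simp add: power_mult)
  then show ?thesis by (simp add: power_increasing_iff)
qed

theorem theorem7p21:
  "\<exists>c::real. c > 0 \<and> (\<forall>k>3. \<forall>n.
     ereal (c * real n) \<le> ereal_of_enat (randomness_complexity k (bit_strings n) (Disj k n)))"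
\<comment> \<open>The counting bound is \<open>n * (k - 1) \<le> d * k\<close>, and
  \<open>(k - 1) / k\<close> is at least 1/2 here.\<close>
proof (intro exI[of _ "1/2"] conjI allI impI)
  fix k n :: nat assume k: "3 < k"
  show "ereal (1 / 2 * real n) \<le> ereal_of_enat (randomness_complexity k (bit_strings n) (Disj k n))"
  proof (cases "randomness_complexity k (bit_strings n) (Disj k n)")
    case (enat d)
    define S where "S = {enat d | d. \<exists>P. is_protocol k (bit_strings n) P \<and> computes k (bit_strings n) (Disj k n) P \<and>
      private_protocol k (bit_strings n) (Disj k n) P \<and> d_random k (bit_strings n) d P}"
    have Inf: "Inf S = enat d" using enat unfolding randomness_complexity_def S_def .
    \<comment> \<open>A finite infimum in \<open>enat\<close> is that of a nonempty set and is
      attained, so some protocol uses at most \<open>d\<close> bits. An infinite value makes the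
      bound trivial.\<close>
    then have "S \<noteq> {}" by (auto simp: Inf_enat_def)
    then have "Inf S \<in> S" by (auto simp: Inf_enat_def intro: LeastI)
    then have "enat d \<in> S" using Inf by simp
    then obtain P where "is_protocol k (bit_strings n) P" "computes k (bit_strings n) (Disj k n) P"
      "private_protocol k (bit_strings n) (Disj k n) P" "d_random k (bit_strings n) d P"
      unfolding S_def by blast
    then have "n * (k - 1) \<le> d * k" using Disj_random_bits_ge[of k n _ d] k by auto
    moreover have "n * k \<le> 2 * (n * (k - 1))" 
    proof -
      have "k \<le> 2 * (k - 1)" using k by simp
      then have "n * k \<le> n * (2 * (k - 1))" by (rule mult_le_mono2)
      then show ?thesis by (simp only: mult.left_commute)
    qed
    ultimately have "n * k \<le> (2 * d) * k" by linarith
    then have "n \<le> 2 * d" using k by simp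
    then show ?thesis using enat by simp
  qed simp
qed simp

end
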